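(* For all $\tau\in\mathbb{H}$ and all $K\in\mathcal{K}$, the limit defining $G_2(K,\tau)$ exists, and the residual function $E(K,\tau)=G_2(K,\tau)-G_2(\tau)$ is given by $$E(K,\tau)=4\int_0^A\frac{h_K(x)}{\tau^2x^2-h_K(x)^2}\,dx,$$ where $A>0$ is a number for which $h_K$ is supported on $[-A,A]$.
   Context: $\mathbb{H}=\{\tau\in\mathbb{C}:\operatorname{Im}(\tau)>0\}$ is the upper half-plane. The weight-2 Eisenstein series is the function on $\mathbb{H}$ defined by the iterated sum $$G_2(\tau)=\sum_{m\in\mathbb{Z}}\Big[\sum_{n\in\mathbb{Z}}\frac{1}{(n+m\tau)^2}\Big],$$ summed in the indicated order (inner sum over $n$, then outer sum over $m$), with the term $(m,n)=(0,0)$ omitted. $\mathcal{K}$ denotes the class of compact convex sets $K\subset\mathbb{R}^2$ with nonempty interior that are symmetric about the $x$-axis and about the $y$-axis (i.e. $(x,y)\in K$ implies $(-x,y)\in K$ and $(x,-y)\in K$). For $K\in\mathcal{K}$, $h_K$ is the real-valued function whose graph is the upper boundary of $K$: $h_K(x)=\max\{y:(x,y)\in K\}$ for $x$ in the projection of $K$ to the $x$-axis, and $h_K(x)=0$ otherwise. It is even and supported on an interval $[-A,A]$ (the projection of $K$ to the $x$-axis), and $-h_K$ is the lower boundary of $K$. For an array $(a_{m,n})_{m,n\in\mathbb{Z}}$ of complex numbers and $K\in\mathcal{K}$, the $K$-summation is $$\sum_K a_{m,n}:=\lim_{\lambda\to\infty}\ \sum_{(m,n)\in(\lambda K)\cap\mathbb{Z}^2}a_{m,n},$$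 provided the limit exists, where $\lambda>0$ is real and $\lambda K=\{\lambda p:p\in K\}$ (so $m$ is the $x$-coordinate and $n$ the $y$-coordinate). The $K$-summation of the weight-2 Eisenstein series is $$G_2(K,\tau):=\sum_K\frac{1}{(m\tau+n)^2},$$ provided the limit exists, with the convention $a_{0,0}=0$. When it is defined, the residual function associated to $K$ is $E(K,\tau):=G_2(K,\tau)-G_2(\tau)$. *)

theory Defs
  imports "HOL-Analysis.Analysis"
begin

definition sym_convex_bodies :: "(real \<times> real) set set" where
  "sym_convex_bodies =
     {K. compact K \<and> convex K \<and> interior K \<noteq> {} \<and>
         (\<forall>x y. (x, y) \<in> K \<longrightarrow> (- x, y) \<in> K \<and> (x, - y) \<in> K)}"

definition upper_boundary :: "(real \<times> real) set \<Rightarrow> real \<Rightarrow> real" where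
  "upper_boundary K x = (if x \<in> fst ` K then (GREATEST y. (x, y) \<in> K) else 0)"

definition lattice_points :: "(real \<times> real) set \<Rightarrow> real \<Rightarrow> (int \<times> int) set" where
  "lattice_points K l = {(m, n). (of_int m, of_int n) \<in> (\<lambda>p. l *\<^sub>R p) ` K}"

text \<open>For bounded \<open>K\<close> and \<open>l > 0\<close> the index set \<open>lattice_points K l\<close> is finite, so the
  partial sums below are genuine finite sums.\<close>

definition K_partial_sum :: "(real \<times> real) set \<Rightarrow> (int \<Rightarrow> int \<Rightarrow> complex) \<Rightarrow> real \<Rightarrow> complex" where
  "K_partial_sum K a l = (\<Sum>(m, n)\<in>lattice_points K l. a m n)"

definition K_summable :: "(real \<times> real) set \<Rightarrow> (int \<Rightarrow> int \<Rightarrow> complex) \<Rightarrow> bool" where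
  "K_summable K a \<longleftrightarrow> (\<exists>L. (K_partial_sum K a \<longlongrightarrow> L) at_top)"

definition K_sum :: "(real \<times> real) set \<Rightarrow> (int \<Rightarrow> int \<Rightarrow> complex) \<Rightarrow> complex" where
  "K_sum K a = Lim at_top (K_partial_sum K a)"

definition eisenstein_term :: "complex \<Rightarrow> int \<Rightarrow> int \<Rightarrow> complex" where
  "eisenstein_term \<tau> m n =
     (if m = 0 \<and> n = 0 then 0 else 1 / (of_int m * \<tau> + of_int n) ^ 2)"

text \<open>For \<open>Im \<tau> > 0\<close> each inner sum converges absolutely, and so does the outer sum of the inner
  sums (for \<open>m \<noteq> 0\<close> they are \<open>\<pi>\<^sup>2 / sin\<^sup>2 (\<pi> m \<tau>)\<close>, which decays exponentially in \<open>\<bar>m\<bar>\<close>); hence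
  unordered sums over the integers give the usual value. The double family itself is not
  summable, so the order of the two sums matters.\<close>

definition G2 :: "complex \<Rightarrow> complex" where
  "G2 \<tau> = (\<Sum>\<^sub>\<infinity>m\<in>UNIV. \<Sum>\<^sub>\<infinity>n\<in>UNIV. eisenstein_term \<tau> m n)"

definition G2_K :: "(real \<times> real) set \<Rightarrow> complex \<Rightarrow> complex" where
  "G2_K K \<tau> = K_sum K (eisenstein_term \<tau>)"

definition residual :: "(real \<times> real) set \<Rightarrow> complex \<Rightarrow> complex" where
  "residual K \<tau> = G2_K K \<tau> - G2 \<tau>"

end

theory Submission
  imports Defs "HOL-Real_Asymp.Real_Asymp"
begin

text \<open>
  The Eisenstein terms decay like \<open>1 / (\<bar>m\<bar> + \<bar>n\<bar>)\<^sup>2\<close>, which just fails to be summable over the lattice;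
  this is why the shape of \<open>K\<close> matters. The failure is carried entirely by a part that can be summed in
  closed form. For \<open>m \<noteq> 0\<close> the term \<open>1 / (m \<tau> + n)\<^sup>2\<close> differs from
    \<open>1 / (m \<tau> + n - 1/2) - 1 / (m \<tau> + n + 1/2) = 1 / ((m \<tau> + n)\<^sup>2 - 1/4)\<close>
  only by \<open>O(1 / (\<bar>m\<bar> + \<bar>n\<bar>)\<^sup>4)\<close>. Hence the array of differences (with the column \<open>m = 0\<close> left as it is)
  is summable over \<open>\<int>\<^sup>2\<close>, and its sum does not depend on the order of summation.

  In the iterated sum defining \<open>G2\<close>, every full column of the telescoping part sums to \<open>0\<close>, so the
  differences sum to exactly \<open>G2 \<tau>\<close> (\<open>has_sum_G2\<close>). The sets \<open>\<lambda>K \<inter> \<int>\<^sup>2\<close> exhaust the lattice because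
  \<open>K\<close> contains a neighbourhood of the origin, so the differences contribute \<open>G2 \<tau>\<close> to the
  \<open>K\<close>-summation as well. The residual function is therefore the limit of the telescoping part over
  \<open>\<lambda>K\<close>.

  The column of \<open>\<lambda>K\<close> over \<open>m\<close> is \<open>\<bar>n\<bar> \<le> N\<close> with \<open>N = \<lfloor>\<lambda> h(m / \<lambda>)\<rfloor>\<close>, and telescoping over it leaves
  \<open>2 M / (m\<^sup>2 \<tau>\<^sup>2 - M\<^sup>2)\<close> with \<open>M = N + 1/2\<close>. The kernel \<open>y / (\<tau>\<^sup>2 x\<^sup>2 - y\<^sup>2)\<close> is homogeneous of degree
  \<open>-1\<close>, so the sum over \<open>m\<close> is a Riemann sum of mesh \<open>1 / \<lambda>\<close> for the kernel evaluated along \<open>y = h(x)\<close>,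
  up to replacing \<open>h\<close> by \<open>M / \<lambda> = h + O(1 / \<lambda>)\<close>. It converges by dominated convergence
  (\<open>residual_kernel_riemann_sum_tendsto\<close>): \<open>h\<close> is continuous inside its support by concavity, and
  the kernel is \<open>O(1 / (\<bar>x\<bar> + \<bar>y\<bar>))\<close>, hence bounded along the graph, which stays away from the origin. The
  factor \<open>4\<close> is the \<open>2\<close> above times the symmetry \<open>m \<mapsto> -m\<close>.
\<close>

section \<open>Lower bounds for linear forms\<close>

text \<open>
  Since \<open>\<tau>\<close> is not real, \<open>1\<close> and \<open>\<tau>\<close> form a real basis of the complex plane, and all norms on the plane
  are equivalent. The imaginary part controls \<open>x\<close>, after which the triangle inequality controls \<open>y\<close>.
\<close>

lemma linear_form_lower_bound:
  fixes \<tau> :: complex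
  assumes "Im \<tau> > 0"
  obtains c where "c > 0"
    "\<And>x y :: real. c * (\<bar>x\<bar> + \<bar>y\<bar>) \<le> norm (of_real x * \<tau> + of_real y)"
proof -
  define D where "D = 1 + (1 + norm \<tau>) / Im \<tau>"
  have D: "D > 0" using assms by (simp add: D_def add_pos_nonneg)
  have "1 / D * (\<bar>x\<bar> + \<bar>y\<bar>) \<le> norm (of_real x * \<tau> + of_real y)" (is "_ \<le> ?n") for x y :: real
  proof -
    have "\<bar>x\<bar> * Im \<tau> = \<bar>Im (of_real x * \<tau> + of_real y)\<bar>"
      using assms by (simp add: abs_mult)
    also have "\<dots> \<le> ?n" by (rule abs_Im_le_cmod)
    finally have x: "\<bar>x\<bar> \<le> ?n / Im \<tau>" using assms by (simp add: field_simps)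
    have "of_real y = (of_real x * \<tau> + of_real y) - of_real x * \<tau>" by simp
    then have "\<bar>y\<bar> \<le> ?n + \<bar>x\<bar> * norm \<tau>"
      by (metis norm_mult norm_of_real norm_triangle_ineq4)
    also have "\<bar>x\<bar> * norm \<tau> \<le> ?n / Im \<tau> * norm \<tau>"
      by (intro mult_right_mono x) auto
    finally have "\<bar>x\<bar> + \<bar>y\<bar> \<le> D * ?n"
      using x unfolding D_def by (simp add: field_simps add_divide_distrib)
    then show ?thesis using D by (simp add: field_simps)
  qed
  with D show thesis by (intro that[of "1 / D"]) auto
qed

text \<open>
  The form in which the linear bound is applied to the factors \<open>m \<tau> + n\<close> and \<open>m \<tau> + n \<plusminus> 1/2\<close>. The condition
  \<open>m \<noteq> 0\<close> absorbs the half-integer shift, and separate bounds in \<open>m\<close> and in \<open>n\<close> make it possible to dominate a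
  product of four factors by a product of a weight in \<open>m\<close> and a weight in \<open>n\<close>.
\<close>

lemma lattice_term_lower_bound:
  fixes \<tau> :: complex
  assumes "Im \<tau> > 0"
  obtains c where "c > 0"
    "\<And>m n y. m \<noteq> 0 \<Longrightarrow> \<bar>y - of_int n\<bar> \<le> 1/2 \<Longrightarrow>
       c * (1 + \<bar>of_int m\<bar>) \<le> norm (of_int m * \<tau> + of_real y)"
    "\<And>m n y. m \<noteq> 0 \<Longrightarrow> \<bar>y - of_int n\<bar> \<le> 1/2 \<Longrightarrow>
       c * (1 + \<bar>of_int n\<bar>) \<le> norm (of_int m * \<tau> + of_real y)"
proof -
  obtain c where c: "c > 0"
    "\<And>x y :: real. c * (\<bar>x\<bar> + \<bar>y\<bar>) \<le> norm (of_real x * \<tau> + of_real y)"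
    using linear_form_lower_bound[OF assms] by metis
  have *: "c / 2 * B \<le> norm (of_int m * \<tau> + of_real y)"
    if "B \<le> 2 * (\<bar>of_int m\<bar> + \<bar>y\<bar>)" for m y B
    using c(2)[of "of_int m" y] mult_left_mono[OF that, of "c / 2"] c(1) by (simp add: algebra_simps)
  show thesis
  proof (rule that[of "c / 2"])
    fix m n :: int and y :: real assume m: "m \<noteq> 0" and y: "\<bar>y - of_int n\<bar> \<le> 1/2"
    from m have "1 \<le> \<bar>m\<bar>" by linarith
    then have m1: "1 \<le> \<bar>of_int m :: real\<bar>" by linarith
    show "c / 2 * (1 + \<bar>of_int m\<bar>) \<le> norm (of_int m * \<tau> + of_real y)"
    proof (rule *)
      show "1 + \<bar>of_int m\<bar> \<le> 2 * (\<bar>of_int m\<bar> + \<bar>y\<bar>)" using m1 abs_ge_zero[of y] by argo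
    qed
    show "c / 2 * (1 + \<bar>of_int n\<bar>) \<le> norm (of_int m * \<tau> + of_real y)"
    proof (rule *)
      have "\<bar>of_int n\<bar> \<le> \<bar>y\<bar> + 1/2" using y by linarith
      then show "1 + \<bar>of_int n\<bar> \<le> 2 * (\<bar>of_int m\<bar> + \<bar>y\<bar>)"
        using m1 abs_ge_zero[of "of_int n :: real"] by argo
    qed
  qed (use c in auto)
qed

definition inverse_square_weight :: "int \<Rightarrow> real" where
  "inverse_square_weight n = 1 / (1 + \<bar>of_int n\<bar>)\<^sup>2"

lemma summable_inverse_square_weight: "inverse_square_weight summable_on UNIV"
proof -
  have s: "(\<lambda>n. 1 / (1 + real n)\<^sup>2) summable_on UNIV"
    using inverse_power_summable[of 2, where 'a = real]
    by (subst summable_on_UNIV_nonneg_real_iff)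
      (auto simp: inverse_eq_divide add.commute dest: summable_Suc_iff[THEN iffD2])
  have pos: "inverse_square_weight summable_on {0..}"
    by (rule iffD2[OF summable_on_reindex_bij_witness[of _ int nat] s])
      (auto simp: inverse_square_weight_def)
  have "inverse_square_weight summable_on {..0}"
    by (rule iffD2[OF summable_on_reindex_bij_witness[of _ uminus uminus] pos])
      (auto simp: inverse_square_weight_def)
  then have "inverse_square_weight summable_on {..<0}"
    by (rule summable_on_subset_banach) auto
  from this pos have "inverse_square_weight summable_on ({..<0} \<union> {0..})"
    by (rule summable_on_Un_disjoint) auto
  also have "{..<0} \<union> {0..} = (UNIV :: int set)" by auto
  finally show ?thesis .
qed

section \<open>The telescoping part and the absolutely summable part\<close>

definition telescoping_term :: "complex \<Rightarrow> int \<Rightarrow> int \<Rightarrow> complex" where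
  "telescoping_term \<tau> m n =
     (if m = 0 then 0
      else 1 / (of_int m * \<tau> + of_real (of_int n - 1/2)) - 1 / (of_int m * \<tau> + of_real (of_int n + 1/2)))"

text \<open>
  The integrand of the residual function, with the height \<open>y\<close> as an independent variable. The lattice sums
  evaluate it at half-integer heights, where it is only close to the integrand.
\<close>

definition residual_kernel :: "complex \<Rightarrow> real \<Rightarrow> real \<Rightarrow> complex" where
  "residual_kernel \<tau> x y = of_real y / (\<tau>\<^sup>2 * (of_real x)\<^sup>2 - (of_real y)\<^sup>2)"

lemma linear_form_nonzero:
  assumes "Im \<tau> > 0" "x \<noteq> 0 \<or> y \<noteq> 0"
  shows "of_real x * \<tau> + of_real y \<noteq> 0"
  using assms by (auto simp: complex_eq_iff)

lemma residual_kernel_denominator: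
  fixes \<tau> :: complex
  shows   "\<tau>\<^sup>2 * (of_real x)\<^sup>2 - (of_real y)\<^sup>2 =
     (of_real x * \<tau> + of_real y) * (of_real x * \<tau> + of_real (- y))"
  by (simp add: power2_eq_square algebra_simps)

text \<open>
  The denominator factors into two linear forms, each at least a multiple of \<open>\<bar>x\<bar> + \<bar>y\<bar>\<close>. The estimate gives both
  the vanishing of full telescoping columns and the domination of the Riemann sums.
\<close>

lemma residual_kernel_bound:
  assumes "Im \<tau> > 0"
  obtains C where "C > 0" "\<And>x y. norm (residual_kernel \<tau> x y) \<le> C / (\<bar>x\<bar> + \<bar>y\<bar>)"
proof -
  obtain c where c: "c > 0"
    "\<And>x y :: real. c * (\<bar>x\<bar> + \<bar>y\<bar>) \<le> norm (of_real x * \<tau> + of_real y)"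
    using linear_form_lower_bound[OF assms] by metis
  have "norm (residual_kernel \<tau> x y) \<le> (1 / c\<^sup>2) / (\<bar>x\<bar> + \<bar>y\<bar>)" for x y
  proof (cases "x = 0 \<and> y = 0")
    case False
    define t where "t = \<bar>x\<bar> + \<bar>y\<bar>"
    have t: "t > 0" "\<bar>y\<bar> \<le> t" using False by (auto simp: t_def)
    have "norm (residual_kernel \<tau> x y)
            = \<bar>y\<bar> / (norm (of_real x * \<tau> + of_real y) * norm (of_real x * \<tau> + of_real (- y)))"
      unfolding residual_kernel_def residual_kernel_denominator by (simp only: norm_divide norm_mult norm_of_real)
    also have "\<dots> \<le> t / ((c * t) * (c * t))"
      using t c(1) c(2)[of x y] c(2)[of x "- y"]
      by (intro frac_le mult_mono mult_pos_pos) (auto simp: t_def)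
    also have "\<dots> = (1 / c\<^sup>2) / t" using t by (simp add: power2_eq_square)
    finally show ?thesis by (simp add: t_def)
  qed (simp add: residual_kernel_def)
  with c(1) show thesis by (intro that[of "1 / c\<^sup>2"]) auto
qed

text \<open>
  The two boundary terms \<open>1 / (m \<tau> - M) - 1 / (m \<tau> + M)\<close> that survive combine to \<open>2 M / (m\<^sup>2 \<tau>\<^sup>2 - M\<^sup>2)\<close>,
  where \<open>M = N + 1/2\<close>.
\<close>

lemma telescoping_column_sum:
  assumes "Im \<tau> > 0" "m \<noteq> 0"
  shows "(\<Sum>n\<in>{-int N..int N}. telescoping_term \<tau> m n) = 2 * residual_kernel \<tau> (of_int m) (real N + 1/2)"
proof -
  define u where "u y = 1 / (of_int m * \<tau> + of_real y)" for y :: real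
  have "(\<Sum>n\<in>{-int N..int N}. telescoping_term \<tau> m n) = u (- real N - 1/2) - u (real N + 1/2)"
  proof (induction N)
    case 0
    show ?case using assms by (simp add: telescoping_term_def u_def)
  next
    case (Suc N)
    have "{-int (Suc N)..int (Suc N)} = insert (- int N - 1) (insert (int N + 1) {-int N..int N})"
      by auto
    then show ?case using Suc assms by (simp add: telescoping_term_def u_def algebra_simps)
  qed
  also have "\<dots> = 2 * residual_kernel \<tau> (of_int m) (real N + 1/2)"
  proof -
    have nz: "of_int m * \<tau> + of_real y \<noteq> 0" for y
      using linear_form_nonzero[of \<tau> "of_int m" y] assms by simp
    have "- real N - 1/2 = - (real N + 1/2)" by simp
    then have "u (- real N - 1/2) - u (real N + 1/2) = u (- (real N + 1/2)) - u (real N + 1/2)"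
      by (rule arg_cong)
    also have "u (- y) - u y = 2 * residual_kernel \<tau> (of_int m) y" for y
      using nz[of y] nz[of "-y"] unfolding residual_kernel_def residual_kernel_denominator u_def
      by (simp add: field_simps)
    finally show ?thesis .
  qed
  finally show ?thesis .
qed

lemma telescoping_term_bound:
  assumes "Im \<tau> > 0"
  obtains C where "\<And>m n. norm (telescoping_term \<tau> m n) \<le> C * inverse_square_weight n"
proof -
  obtain c where c: "c > 0"
    "\<And>m n y. m \<noteq> 0 \<Longrightarrow> \<bar>y - of_int n\<bar> \<le> 1/2 \<Longrightarrow>
       c * (1 + \<bar>of_int n\<bar>) \<le> norm (of_int m * \<tau> + of_real y)"
    using lattice_term_lower_bound[OF assms] by metis
  have "norm (telescoping_term \<tau> m n) \<le> 1 / c\<^sup>2 * inverse_square_weight n" for m n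
  proof (cases "m = 0")
    case True
    then show ?thesis by (simp add: telescoping_term_def inverse_square_weight_def)
  next
    case False
    define p q where "p = of_int m * \<tau> + of_real (of_int n - 1/2)"
      and "q = of_int m * \<tau> + of_real (of_int n + 1/2)"
    have nz: "p \<noteq> 0" "q \<noteq> 0"
      using linear_form_nonzero[OF assms, of "of_int m"] False unfolding p_def q_def
      by (metis of_int_eq_0_iff of_real_of_int_eq)+
    have "telescoping_term \<tau> m n = 1 / p - 1 / q"
      using False by (simp only: telescoping_term_def p_def q_def if_False)
    also have "\<dots> = (q - p) / (p * q)" using nz by (simp add: field_simps)
    also have "q - p = 1" by (simp add: p_def q_def)
    finally have "telescoping_term \<tau> m n = 1 / (p * q)" .
    then have "norm (telescoping_term \<tau> m n) = 1 / (norm p * norm q)"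
      by (simp add: norm_divide norm_mult)
    also have "\<dots> \<le> 1 / ((c * (1 + \<bar>of_int n\<bar>)) * (c * (1 + \<bar>of_int n\<bar>)))"
    proof (intro frac_le mult_mono)
      show "c * (1 + \<bar>of_int n\<bar>) \<le> norm p" unfolding p_def using False by (intro c(2)) auto
      show "c * (1 + \<bar>of_int n\<bar>) \<le> norm q" unfolding q_def using False by (intro c(2)) auto
    qed (use c(1) in \<open>auto intro!: mult_pos_pos add_pos_nonneg\<close>)
    also have "\<dots> = 1 / c\<^sup>2 * inverse_square_weight n"
      by (simp add: inverse_square_weight_def power2_eq_square)
    finally show ?thesis .
  qed
  then show thesis by (rule that)
qed

text \<open>
  With \<open>s = m \<tau> + n\<close> the difference is \<open>1 / s\<^sup>2 - 1 / (s\<^sup>2 - 1/4) = - 1 / (4 s\<^sup>2 (s\<^sup>2 - 1/4))\<close>, of order four in the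
  size of the lattice point. Two of the four factors are spent on decay in \<open>m\<close> and two on decay in \<open>n\<close>. The
  column \<open>m = 0\<close> has no telescoping part, and there the series of inverse squares converges by itself.
\<close>

lemma eisenstein_minus_telescoping_bound:
  assumes "Im \<tau> > 0"
  obtains C where "\<And>m n. norm (eisenstein_term \<tau> m n - telescoping_term \<tau> m n)
                     \<le> C * (inverse_square_weight m * inverse_square_weight n)"
proof -
  obtain c where c: "c > 0"
    "\<And>m n y. m \<noteq> 0 \<Longrightarrow> \<bar>y - of_int n\<bar> \<le> 1/2 \<Longrightarrow>
       c * (1 + \<bar>of_int m\<bar>) \<le> norm (of_int m * \<tau> + of_real y)"
    "\<And>m n y. m \<noteq> 0 \<Longrightarrow> \<bar>y - of_int n\<bar> \<le> 1/2 \<Longrightarrow>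
       c * (1 + \<bar>of_int n\<bar>) \<le> norm (of_int m * \<tau> + of_real y)"
    using lattice_term_lower_bound[OF assms] by metis
  \<comment> \<open>The summand \<open>4\<close> serves the column \<open>m = 0\<close>, where \<open>1 + \<bar>n\<bar> \<le> 2 \<bar>n\<bar>\<close>.\<close>
  define C where "C = 4 + 1 / (4 * c ^ 4)"
  have C: "4 \<le> C" "1 / (4 * c ^ 4) \<le> C" using c(1) by (auto simp: C_def)
  have "norm (eisenstein_term \<tau> m n - telescoping_term \<tau> m n)
          \<le> C * (inverse_square_weight m * inverse_square_weight n)" for m n
  proof (cases "m = 0")
    case True
    have "norm (eisenstein_term \<tau> 0 n) \<le> 4 * inverse_square_weight n"
    proof (cases "n = 0")
      case False
      then have "1 \<le> \<bar>n\<bar>" by linarith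
      then have "1 + \<bar>of_int n\<bar> \<le> 2 * \<bar>of_int n :: real\<bar>" by linarith
      then have "(1 + \<bar>of_int n\<bar>)\<^sup>2 \<le> (2 * \<bar>of_int n :: real\<bar>)\<^sup>2" by (intro power_mono) auto
      then have "1 / (of_int n)\<^sup>2 \<le> 4 * inverse_square_weight n"
        using False by (simp add: inverse_square_weight_def field_simps)
      moreover have "norm (eisenstein_term \<tau> 0 n) = 1 / (of_int n)\<^sup>2"
        using False by (simp add: eisenstein_term_def norm_divide norm_power)
      ultimately show ?thesis by simp
    qed (simp add: eisenstein_term_def inverse_square_weight_def)
    also have "\<dots> \<le> C * inverse_square_weight n"
      using C by (intro mult_right_mono) (auto simp: inverse_square_weight_def)
    finally show ?thesis using True by (simp add: telescoping_term_def inverse_square_weight_def)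
  next
    case False
    define s p q where "s = of_int m * \<tau> + of_real (of_int n)"
      and "p = of_int m * \<tau> + of_real (of_int n - 1/2)"
      and "q = of_int m * \<tau> + of_real (of_int n + 1/2)"
    have nz: "s \<noteq> 0" "p \<noteq> 0" "q \<noteq> 0"
      using linear_form_nonzero[OF assms, of "of_int m"] False unfolding p_def q_def s_def
      by (metis of_int_eq_0_iff of_real_of_int_eq)+
    have pq: "p = s - 1/2" "q = s + 1/2" by (auto simp: s_def p_def q_def)
    have "eisenstein_term \<tau> m n - telescoping_term \<tau> m n = 1 / s\<^sup>2 - (1 / p - 1 / q)"
      using False by (simp add: eisenstein_term_def telescoping_term_def s_def p_def q_def)
    also have "1 / p - 1 / q = (q - p) / (p * q)" using nz by (simp add: field_simps)
    also have "q - p = 1" by (simp add: pq)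
    also have "1 / s\<^sup>2 - 1 / (p * q) = (p * q - s\<^sup>2) / ((s * s) * (p * q))"
      using nz by (simp add: field_simps power2_eq_square)
    also have "p * q - s\<^sup>2 = - 1 / 4" by (simp add: pq field_simps power2_eq_square)
    finally have "norm (eisenstein_term \<tau> m n - telescoping_term \<tau> m n)
        = (1 / 4) / ((norm s * norm s) * (norm p * norm q))"
      by (simp add: norm_divide norm_mult)
    also have "\<dots> \<le> (1 / 4) / (((c * (1 + \<bar>of_int m\<bar>)) * (c * (1 + \<bar>of_int m\<bar>))) *
                                ((c * (1 + \<bar>of_int n\<bar>)) * (c * (1 + \<bar>of_int n\<bar>))))"
    proof (intro divide_left_mono mult_mono)
      show "c * (1 + \<bar>of_int m\<bar>) \<le> norm s" unfolding s_def using False by (rule c(2)[of _ _ n]) simp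
      then show "c * (1 + \<bar>of_int m\<bar>) \<le> norm s" .
      show "c * (1 + \<bar>of_int n\<bar>) \<le> norm p" unfolding p_def using False by (intro c(3)) auto
      show "c * (1 + \<bar>of_int n\<bar>) \<le> norm q" unfolding q_def using False by (intro c(3)) auto
    qed (use c(1) nz in \<open>auto intro!: mult_pos_pos add_pos_nonneg\<close>)
    also have "\<dots> = 1 / (4 * c ^ 4) * (inverse_square_weight m * inverse_square_weight n)"
      by (simp add: inverse_square_weight_def power2_eq_square power4_eq_xxxx mult_ac)
    also have "\<dots> \<le> C * (inverse_square_weight m * inverse_square_weight n)"
      using C by (intro mult_right_mono) (auto simp: inverse_square_weight_def)
    finally show ?thesis .
  qed
  then show thesis by (rule that)
qed

lemma has_sum_int_via_symmetric_partial_sums: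
  fixes f :: "int \<Rightarrow> complex"
  assumes "f summable_on UNIV" and "(\<lambda>N. \<Sum>n\<in>{-int N..int N}. f n) \<longlonglongrightarrow> S"
  shows "(f has_sum S) UNIV"
proof -
  have "filterlim (\<lambda>N. {-int N..int N}) (finite_subsets_at_top UNIV) sequentially"
    unfolding filterlim_finite_subsets_at_top
  proof (intro allI impI)
    fix X :: "int set" assume "finite X \<and> X \<subseteq> UNIV"
    then have fin: "finite ((\<lambda>n. nat \<bar>n\<bar>) ` X)" by simp
    show "\<forall>\<^sub>F N in sequentially. finite {-int N..int N} \<and> X \<subseteq> {-int N..int N} \<and> {-int N..int N} \<subseteq> UNIV"
      using eventually_ge_at_top[of "Max ((\<lambda>n. nat \<bar>n\<bar>) ` X)"]
    proof eventually_elim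
      case (elim N)
      have "nat \<bar>n\<bar> \<le> N" if "n \<in> X" for n
        using Max_ge[OF fin, of "nat \<bar>n\<bar>"] that elim by auto
      then show ?case by fastforce
    qed
  qed
  with assms(1) have "(\<lambda>N. \<Sum>n\<in>{-int N..int N}. f n) \<longlonglongrightarrow> infsum f UNIV"
    using filterlim_compose has_sum_infsum unfolding has_sum_def by blast
  with assms show ?thesis using LIMSEQ_unique has_sum_infsum by metis
qed

text \<open>
  A full column contributes nothing: the symmetric partial sums reduce to the boundary terms, which tend
  to \<open>0\<close>. This is why the telescoping part is invisible in the iterated sum \<open>G2\<close>.
\<close>

lemma has_sum_telescoping_column:
  assumes "Im \<tau> > 0"
  shows "(telescoping_term \<tau> m has_sum 0) UNIV"
proof (cases "m = 0")
  case True
  then show ?thesis by (simp add: telescoping_term_def has_sum_0)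
next
  case False
  obtain C where C: "\<And>m n. norm (telescoping_term \<tau> m n) \<le> C * inverse_square_weight n"
    using telescoping_term_bound[OF assms] by metis
  have "telescoping_term \<tau> m summable_on UNIV"
    by (rule abs_summable_summable,
        rule Infinite_Sum.abs_summable_on_comparison_test'[OF summable_on_cmult_right[OF summable_inverse_square_weight, of C]],
        rule C)
  moreover have "(\<lambda>N. \<Sum>n\<in>{-int N..int N}. telescoping_term \<tau> m n) \<longlonglongrightarrow> 0"
  proof -
    obtain B where B: "B > 0" "\<And>x y. norm (residual_kernel \<tau> x y) \<le> B / (\<bar>x\<bar> + \<bar>y\<bar>)"
      using residual_kernel_bound[OF assms] by metis
    have "(\<lambda>N. B / (\<bar>of_int m\<bar> + \<bar>real N + 1/2\<bar>)) \<longlonglongrightarrow> 0"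
      by real_asymp
    then have "(\<lambda>N. residual_kernel \<tau> (of_int m) (real N + 1/2)) \<longlonglongrightarrow> 0"
      by (rule Lim_null_comparison[rotated]) (intro always_eventually allI B)
    from tendsto_mult_right_zero[OF this, of 2] show ?thesis
      unfolding telescoping_column_sum[OF assms False] .
  qed
  ultimately show ?thesis by (rule has_sum_int_via_symmetric_partial_sums)
qed

lemma summable_eisenstein_minus_telescoping:
  assumes "Im \<tau> > 0"
  shows "(\<lambda>(m, n). eisenstein_term \<tau> m n - telescoping_term \<tau> m n) summable_on UNIV"
proof -
  obtain C where C: "\<And>m n. norm (eisenstein_term \<tau> m n - telescoping_term \<tau> m n)
                     \<le> C * (inverse_square_weight m * inverse_square_weight n)"
    using eisenstein_minus_telescoping_bound[OF assms] by metis
  let ?w = inverse_square_weight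
  have w: "0 \<le> ?w n" for n by (simp add: inverse_square_weight_def)
  have "(\<lambda>p. ?w (fst p) * ?w (snd p)) summable_on (UNIV \<times> UNIV)"
    using summable_inverse_square_weight w
    by (intro summable_on_SigmaI[where g = "\<lambda>m. ?w m * infsum ?w UNIV"])
       (auto intro!: has_sum_cmult_right summable_on_cmult_left)
  then have "(\<lambda>p. C * (?w (fst p) * ?w (snd p))) summable_on UNIV"
    by (intro summable_on_cmult_right) simp
  then show ?thesis
    by (rule abs_summable_summable[OF Infinite_Sum.abs_summable_on_comparison_test']) (use C in auto)
qed

text \<open>
  Subtracting the telescoping part replaces the conditionally convergent double series \<open>G2\<close> by an
  unconditional sum over the lattice.
\<close>

lemma has_sum_G2:
  assumes "Im \<tau> > 0"
  shows "((\<lambda>(m, n). eisenstein_term \<tau> m n - telescoping_term \<tau> m n) has_sum G2 \<tau>) UNIV"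
proof -
  let ?d = "\<lambda>m n. eisenstein_term \<tau> m n - telescoping_term \<tau> m n"
  note s = summable_eisenstein_minus_telescoping[OF assms]
  have col: "infsum (eisenstein_term \<tau> m) UNIV = infsum (?d m) UNIV" for m
  proof -
    have "?d m summable_on UNIV"
      using summable_on_SigmaD1[of ?d UNIV "\<lambda>_. UNIV" m] s by simp
    from has_sum_add[OF has_sum_infsum[OF this] has_sum_telescoping_column[OF assms, of m]]
    have "((\<lambda>n. eisenstein_term \<tau> m n) has_sum infsum (?d m) UNIV) UNIV" by simp
    then show ?thesis by (rule infsumI)
  qed
  have "G2 \<tau> = (\<Sum>\<^sub>\<infinity>m\<in>UNIV. \<Sum>\<^sub>\<infinity>n\<in>UNIV. ?d m n)"
    unfolding G2_def using col by simp
  also have "\<dots> = infsum (\<lambda>(m, n). ?d m n) UNIV"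
    using infsum_Sigma'_banach[of ?d UNIV "\<lambda>_. UNIV"] s by simp
  finally show ?thesis using s by simp
qed

section \<open>Symmetric convex bodies and their upper boundary\<close>

definition half_width :: "(real \<times> real) set \<Rightarrow> real" where
  "half_width K = Sup (fst ` K)"

lemma sym_convex_bodiesD:
  assumes "K \<in> sym_convex_bodies"
  shows "compact K" "convex K" "interior K \<noteq> {}"
    "(x, y) \<in> K \<Longrightarrow> (- x, y) \<in> K" "(x, y) \<in> K \<Longrightarrow> (x, - y) \<in> K"
  using assms by (auto simp: sym_convex_bodies_def)

text \<open>
  If \<open>K\<close> contains a ball around \<open>p\<close>, it contains the ball of the same radius around \<open>- p\<close> by symmetry, and hence, by
  convexity, the ball around the midpoint \<open>0\<close>.
\<close>

lemma sym_convex_bodies_contains_square: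
  assumes "K \<in> sym_convex_bodies"
  obtains r where "r > 0" "\<And>x y. \<bar>x\<bar> \<le> r \<Longrightarrow> \<bar>y\<bar> \<le> r \<Longrightarrow> (x, y) \<in> K"
proof -
  note K = sym_convex_bodiesD[OF assms]
  obtain p e where e: "e > 0" "cball p e \<subseteq> K"
    using K(3) by (metis ex_in_conv mem_interior_cball)
  have "q \<in> K" if "norm q \<le> e" for q
  proof -
    have "p + q \<in> K" using e(2) that by (auto simp: dist_norm)
    moreover have "q - p \<in> K"
    proof -
      have "p - q \<in> K" using e(2) that by (auto simp: dist_norm)
      then have "(fst p - fst q, snd p - snd q) \<in> K" by (metis minus_prod_def)
      from K(5)[OF K(4)[OF this]] show ?thesis by (simp add: minus_prod_def)
    qed
    ultimately have "(1/2) *\<^sub>R (p + q) + (1/2) *\<^sub>R (q - p) \<in> K"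
      using K(2) by (intro convexD) auto
    then show ?thesis by (simp add: algebra_simps flip: scaleR_add_left)
  qed
  moreover have "norm (x, y) \<le> e" if "\<bar>x\<bar> \<le> e / 2" "\<bar>y\<bar> \<le> e / 2" for x y
    using norm_Pair_le[of x y] that by simp
  ultimately show thesis using e(1) by (intro that[of "e / 2"]) auto
qed

lemma fst_image_sym_convex_body:
  assumes "K \<in> sym_convex_bodies"
  shows "fst ` K = {- half_width K..half_width K}"
proof -
  note K = sym_convex_bodiesD[OF assms]
  let ?P = "fst ` K"
  have cpt: "compact ?P" using K(1) by (intro compact_continuous_image continuous_intros)
  have ne: "?P \<noteq> {}" using K(3) interior_subset by fastforce
  have bdd: "bdd_above ?P" by (intro bounded_imp_bdd_above compact_imp_bounded cpt)
  have max: "half_width K \<in> ?P"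
    unfolding half_width_def using cpt ne bdd by (intro closed_contains_Sup compact_imp_closed)
  have neg: "- x \<in> ?P" if "x \<in> ?P" for x
    using that K(4) by force
  have le: "x \<le> half_width K" if "x \<in> ?P" for x
    unfolding half_width_def using cSup_upper[OF that bdd] .
  have "convex ?P" using K(2) by (intro convex_linear_image) (auto intro: linear_fst)
  then have "is_interval ?P" by (simp add: is_interval_convex_1)
  then have "{- half_width K..half_width K} \<subseteq> ?P"
    using max neg[OF max] by (meson atLeastAtMost_iff mem_is_interval_1_I subsetI)
  moreover have "?P \<subseteq> {- half_width K..half_width K}"
    using le neg by force
  ultimately show ?thesis by blast
qed

text \<open>
  Compactness of the vertical sections makes the greatest element in the definition of the upper boundary
  exist.
\<close>

lemma upper_boundary_in_body:
  assumes "K \<in> sym_convex_bodies" "\<bar>x\<bar> \<le> half_width K"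
  shows "(x, upper_boundary K x) \<in> K" "(x, y) \<in> K \<Longrightarrow> y \<le> upper_boundary K x"
proof -
  note K = sym_convex_bodiesD[OF assms(1)]
  let ?S = "{y. (x, y) \<in> K}"
  have x: "x \<in> fst ` K" using fst_image_sym_convex_body[OF assms(1)] assms(2) by auto
  then have ne: "?S \<noteq> {}" by auto
  have S: "?S = snd ` (K \<inter> {x} \<times> UNIV)" by force
  have "compact ?S" unfolding S using K(1)
    by (intro compact_continuous_image continuous_intros compact_Int_closed closed_Times) auto
  then obtain y0 where y0: "y0 \<in> ?S" "\<And>y. y \<in> ?S \<Longrightarrow> y \<le> y0"
    using compact_attains_sup[OF _ ne] by blast
  then have "upper_boundary K x = y0"
    using x by (auto simp: upper_boundary_def intro!: Greatest_equality)
  then show "(x, upper_boundary K x) \<in> K" "(x, y) \<in> K \<Longrightarrow> y \<le> upper_boundary K x"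
    using y0 by auto
qed

lemma mem_sym_convex_body_iff:
  assumes "K \<in> sym_convex_bodies"
  shows "(x, y) \<in> K \<longleftrightarrow> \<bar>x\<bar> \<le> half_width K \<and> \<bar>y\<bar> \<le> upper_boundary K x"
proof safe
  note K = sym_convex_bodiesD[OF assms]
  {
    assume xy: "(x, y) \<in> K"
    then have "x \<in> fst ` K" by force
    then show x: "\<bar>x\<bar> \<le> half_width K" using fst_image_sym_convex_body[OF assms] by auto
    show "\<bar>y\<bar> \<le> upper_boundary K x"
      using upper_boundary_in_body(2)[OF assms x] xy K(5)[OF xy] by (auto simp: abs_le_iff)
  next
    let ?h = "upper_boundary K x"
    assume x: "\<bar>x\<bar> \<le> half_width K" and y: "\<bar>y\<bar> \<le> ?h"
    have top: "(x, ?h) \<in> K" by (rule upper_boundary_in_body[OF assms x])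
    show "(x, y) \<in> K"
    proof (cases "?h = 0")
      case False
      with y have h: "?h > 0" by linarith
      define t where "t = (1 + y / ?h) / 2"
      have t: "0 \<le> t" "t \<le> 1" using y h by (auto simp: t_def field_simps abs_le_iff)
      have "t *\<^sub>R (x, ?h) + (1 - t) *\<^sub>R (x, - ?h) \<in> K"
        using t top K(5)[OF top] K(2) by (intro convexD) auto
      also have "t *\<^sub>R (x, ?h) + (1 - t) *\<^sub>R (x, - ?h) = (x, y)"
        using h by (simp add: t_def field_simps)
      finally show ?thesis .
    qed (use top y in auto)
  }
qed

lemma upper_boundary_outside:
  assumes "K \<in> sym_convex_bodies" "\<bar>x\<bar> > half_width K"
  shows "upper_boundary K x = 0"
  using assms fst_image_sym_convex_body[OF assms(1)] by (auto simp: upper_boundary_def)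

lemma upper_boundary_nonneg:
  assumes "K \<in> sym_convex_bodies"
  shows "upper_boundary K x \<ge> 0"
proof (cases "\<bar>x\<bar> \<le> half_width K")
  case True
  from upper_boundary_in_body(1)[OF assms this] show ?thesis
    using mem_sym_convex_body_iff[OF assms] by force
qed (simp add: upper_boundary_outside assms)

lemma upper_boundary_even:
  assumes "K \<in> sym_convex_bodies"
  shows "upper_boundary K (- x) = upper_boundary K x"
proof (cases "\<bar>x\<bar> \<le> half_width K")
  case True
  note b = upper_boundary_in_body[OF assms]
  show ?thesis
    using b[of x] b[of "- x"] sym_convex_bodiesD(4)[OF assms] True
    by (metis abs_minus_cancel add.inverse_inverse order_antisym)
qed (simp add: upper_boundary_outside assms)

lemma concave_on_upper_boundary:
  assumes "K \<in> sym_convex_bodies"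
  shows "concave_on {- half_width K..half_width K} (upper_boundary K)"
  unfolding concave_on_iff
proof (intro conjI ballI allI impI)
  fix x y u v :: real
  assume x: "x \<in> {- half_width K..half_width K}" and y: "y \<in> {- half_width K..half_width K}"
    and uv: "0 \<le> u" "0 \<le> v" "u + v = 1"
  have "u *\<^sub>R (x, upper_boundary K x) + v *\<^sub>R (y, upper_boundary K y) \<in> K"
    using x y uv upper_boundary_in_body(1)[OF assms] sym_convex_bodiesD(2)[OF assms]
    by (intro convexD) auto
  then have "(u *\<^sub>R x + v *\<^sub>R y, u * upper_boundary K x + v * upper_boundary K y) \<in> K" by simp
  then show "u * upper_boundary K x + v * upper_boundary K y \<le> upper_boundary K (u *\<^sub>R x + v *\<^sub>R y)"
    using mem_sym_convex_body_iff[OF assms] by force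
qed auto

text \<open>
  Concavity gives continuity in the interior of the support. At the end points continuity can fail (for a
  rectangle the upper boundary jumps to \<open>0\<close>), but these are only two points.
\<close>

lemma isCont_upper_boundary:
  assumes "K \<in> sym_convex_bodies" "\<bar>x\<bar> < half_width K"
  shows "isCont (upper_boundary K) x"
proof -
  let ?I = "{- half_width K<..<half_width K}"
  have "convex_on ?I (\<lambda>x. - upper_boundary K x)"
    using concave_on_upper_boundary[OF assms(1)] unfolding concave_on_def
    by (rule convex_on_subset) auto
  then have "continuous_on ?I (\<lambda>x. - upper_boundary K x)"
    by (intro convex_on_continuous) auto
  then have "continuous_on ?I (upper_boundary K)"
    using continuous_on_minus by fastforce
  then show ?thesis using assms(2) by (auto simp: continuous_on_eq_continuous_at abs_less_iff)
qed

lemma half_width_pos: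
  assumes "K \<in> sym_convex_bodies"
  shows "half_width K > 0"
proof -
  obtain r where r: "r > 0" "\<And>x y. \<bar>x\<bar> \<le> r \<Longrightarrow> \<bar>y\<bar> \<le> r \<Longrightarrow> (x, y) \<in> K"
    using sym_convex_bodies_contains_square[OF assms] by metis
  have "(r, 0) \<in> K" using r by simp
  then show ?thesis using mem_sym_convex_body_iff[OF assms] r by fastforce
qed

lemma upper_boundary_pos:
  assumes "K \<in> sym_convex_bodies" "0 \<le> x" "x < half_width K"
  shows "upper_boundary K x > 0"
proof -
  let ?A = "half_width K"
  have A: "?A > 0" using assms by linarith
  obtain r where r: "r > 0" "\<And>x y. \<bar>x\<bar> \<le> r \<Longrightarrow> \<bar>y\<bar> \<le> r \<Longrightarrow> (x, y) \<in> K"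
    using sym_convex_bodies_contains_square[OF assms(1)] by metis
  have "(0, r) \<in> K" using r by simp
  then have "0 < upper_boundary K 0" using mem_sym_convex_body_iff[OF assms(1)] r by fastforce
  then have "0 < (1 - x / ?A) * upper_boundary K 0" using assms A by simp
  also have "\<dots> \<le> (1 - x / ?A) * upper_boundary K 0 + (x / ?A) * upper_boundary K ?A"
    using upper_boundary_nonneg[OF assms(1)] assms A by simp
  also have "\<dots> \<le> upper_boundary K ((1 - x / ?A) *\<^sub>R 0 + (x / ?A) *\<^sub>R ?A)"
    using assms A by (intro concave_onD[OF concave_on_upper_boundary[OF assms(1)]]) auto
  finally show ?thesis using A by simp
qed

text \<open>
  The upper boundary is positive up to \<open>half_width K\<close>, so every closed symmetric interval that contains its
  support contains the whole projection of \<open>K\<close>.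
\<close>

lemma half_width_le_support_bound:
  assumes "K \<in> sym_convex_bodies" "A > 0" "{x. upper_boundary K x \<noteq> 0} \<subseteq> {-A..A}"
  shows "half_width K \<le> A"
proof (rule ccontr)
  assume *: "\<not> half_width K \<le> A"
  define x where "x = (A + half_width K) / 2"
  have x: "A < x" "x < half_width K" using * by (auto simp: x_def)
  then have "upper_boundary K x > 0" using assms(2) by (intro upper_boundary_pos assms) auto
  then have "x \<in> {-A..A}" by (intro subsetD[OF assms(3)]) simp
  with x show False by simp
qed

section \<open>Lattice points, column by column\<close>

definition column_height :: "(real \<times> real) set \<Rightarrow> real \<Rightarrow> int \<Rightarrow> nat" where
  "column_height K l m = nat \<lfloor>l * upper_boundary K (of_int m / l)\<rfloor>"

lemma lattice_points_eq_Sigma: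
  assumes "K \<in> sym_convex_bodies" "l > 0"
  shows "lattice_points K l =
    (SIGMA m:{-\<lfloor>l * half_width K\<rfloor>..\<lfloor>l * half_width K\<rfloor>}. {-int (column_height K l m)..int (column_height K l m)})"
proof -
  have img: "p \<in> (\<lambda>p. l *\<^sub>R p) ` K \<longleftrightarrow> (1 / l) *\<^sub>R p \<in> K" for p :: "real \<times> real"
    using assms(2) by (auto simp: image_iff intro!: bexI[of _ "(1 / l) *\<^sub>R p"])
  have "(m, n) \<in> lattice_points K l \<longleftrightarrow>
     m \<in> {-\<lfloor>l * half_width K\<rfloor>..\<lfloor>l * half_width K\<rfloor>} \<and> n \<in> {-int (column_height K l m)..int (column_height K l m)}" for m n
  proof -
    have abs_floor: "\<bar>of_int k\<bar> \<le> z \<longleftrightarrow> - \<lfloor>z\<rfloor> \<le> k \<and> k \<le> \<lfloor>z\<rfloor>" for k and z :: real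
      by (auto simp: le_floor_iff abs_le_iff minus_le_iff[of "\<lfloor>z\<rfloor>"])
    have "\<bar>of_int m / l\<bar> \<le> half_width K \<longleftrightarrow> \<bar>of_int m\<bar> \<le> l * half_width K"
      using assms(2) by (simp add: abs_divide field_simps)
    moreover have "\<bar>of_int n / l\<bar> \<le> upper_boundary K (of_int m / l) \<longleftrightarrow>
        \<bar>of_int n\<bar> \<le> l * upper_boundary K (of_int m / l)"
      using assms(2) by (simp add: abs_divide field_simps)
    moreover have "int (column_height K l m) = \<lfloor>l * upper_boundary K (of_int m / l)\<rfloor>"
      unfolding column_height_def using upper_boundary_nonneg[OF assms(1)] assms(2) by simp
    ultimately show ?thesis
      unfolding lattice_points_def
      using mem_sym_convex_body_iff[OF assms(1), of "of_int m / l" "of_int n / l"] assms(2)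
      by (simp add: img abs_floor)
  qed
  then show ?thesis by auto
qed

text \<open>
  The dilates of \<open>K\<close> eventually contain every finite set of lattice points, since \<open>K\<close> contains a square around
  the origin. So unconditional sums over the lattice are limits along \<open>lattice_points K\<close>.
\<close>

lemma filterlim_lattice_points:
  assumes "K \<in> sym_convex_bodies"
  shows "filterlim (lattice_points K) (finite_subsets_at_top UNIV) at_top"
  unfolding filterlim_finite_subsets_at_top
proof (intro allI impI)
  fix X :: "(int \<times> int) set"
  assume "finite X \<and> X \<subseteq> UNIV"
  then have fin: "finite X" by simp
  obtain r where r: "r > 0" "\<And>x y. \<bar>x\<bar> \<le> r \<Longrightarrow> \<bar>y\<bar> \<le> r \<Longrightarrow> (x, y) \<in> K"
    using sym_convex_bodies_contains_square[OF assms] by metis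
  have "\<forall>\<^sub>F l in at_top. p \<in> lattice_points K l" for p
  proof (cases p)
    case (Pair m n)
    show ?thesis
      using eventually_gt_at_top[of 0] eventually_ge_at_top[of "(\<bar>of_int m\<bar> + \<bar>of_int n\<bar>) / r"]
    proof eventually_elim
      case (elim l)
      then have "\<bar>of_int m / l\<bar> \<le> r" "\<bar>of_int n / l\<bar> \<le> r"
        using r(1) by (auto simp: field_simps abs_divide)
      from r(2)[OF this] show ?case
        using elim unfolding lattice_points_def Pair
        by (auto simp: image_iff intro!: bexI[of _ "(of_int m / l, of_int n / l)"])
    qed
  qed
  then have "\<forall>\<^sub>F l in at_top. \<forall>p\<in>X. p \<in> lattice_points K l"
    using fin by (simp add: eventually_ball_finite)
  with eventually_gt_at_top[of 0]
  show "\<forall>\<^sub>F l in at_top. finite (lattice_points K l) \<and> X \<subseteq> lattice_points K l \<and> lattice_points K l \<subseteq> UNIV"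
    by eventually_elim (use lattice_points_eq_Sigma[OF assms] in auto)
qed

section \<open>The Riemann sum\<close>

lemma has_integral_step_function:
  fixes F :: "int \<Rightarrow> complex"
  assumes "l > 0" "of_int k / l \<le> A"
  shows "((\<lambda>x. if \<lceil>l * x\<rceil> \<in> {1..k} then F \<lceil>l * x\<rceil> else 0) has_integral (\<Sum>m=1..k. F m / of_real l)) {0..A}"
proof -
  have cell: "((\<lambda>x. if x \<in> {(of_int m - 1) / l<..of_int m / l} then F m else 0)
                 has_integral (F m / of_real l)) {0..A}" if m: "m \<in> {1..k}" for m
  proof -
    let ?a = "(of_int m - 1) / l" and ?b = "of_int m / l"
    have "?b \<le> of_int k / l" using m assms(1) by (simp add: divide_right_mono)
    then have sub: "{?a..?b} \<subseteq> {0..A}" using m assms by auto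
    have "?b - ?a = 1 / l" by (simp add: diff_divide_distrib)
    moreover have "?a \<le> ?b" using assms(1) by (simp add: divide_right_mono)
    ultimately have "((\<lambda>x. F m) has_integral (F m / of_real l)) {?a..?b}"
      using has_integral_const_real[of "F m" ?a ?b]
      by (simp add: scaleR_conv_of_real)
    then have "((\<lambda>x. if x \<in> {?a..?b} then F m else 0) has_integral (F m / of_real l)) {0..A}"
      using has_integral_restrict[OF sub, of "\<lambda>_. F m"] by simp
    then show ?thesis
      by (rule has_integral_spike_finite[of "{?a}", rotated 2]) auto
  qed
  have "((\<lambda>x. \<Sum>m=1..k. if x \<in> {(of_int m - 1) / l<..of_int m / l} then F m else 0)
           has_integral (\<Sum>m=1..k. F m / of_real l)) {0..A}"
    by (intro has_integral_sum cell) auto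
  moreover have "(\<Sum>m=1..k. if x \<in> {(of_int m - 1) / l<..of_int m / l} then F m else 0)
      = (if \<lceil>l * x\<rceil> \<in> {1..k} then F \<lceil>l * x\<rceil> else 0)" for x
  proof -
    have "x \<in> {(of_int m - 1) / l<..of_int m / l} \<longleftrightarrow> m = \<lceil>l * x\<rceil>" for m
      using assms(1) by (auto simp: ceiling_eq_iff field_simps eq_commute[of m])
    then show ?thesis by (simp add: sum.delta)
  qed
  ultimately show ?thesis by simp
qed

text \<open>
  Homogeneity of degree \<open>-1\<close> is what makes the boundary terms of the columns a Riemann sum.
\<close>

lemma residual_kernel_scale:
  assumes "l > 0"
  shows "of_real l * residual_kernel \<tau> x y = residual_kernel \<tau> (x / l) (y / l)"
proof -
  have "\<tau>\<^sup>2 * (of_real (x / l))\<^sup>2 - (of_real (y / l))\<^sup>2 =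
        (\<tau>\<^sup>2 * (of_real x)\<^sup>2 - (of_real y)\<^sup>2) / (of_real l)\<^sup>2"
    by (simp add: power_divide diff_divide_distrib)
  then show ?thesis using assms unfolding residual_kernel_def
    by (simp add: power2_eq_square)
qed

lemma column_height_approx:
  assumes "K \<in> sym_convex_bodies" "l > 0"
  shows "\<bar>(real (column_height K l m) + 1/2) / l - upper_boundary K (of_int m / l)\<bar> \<le> 1 / (2 * l)"
proof -
  let ?z = "l * upper_boundary K (of_int m / l)"
  have "real (column_height K l m) = of_int \<lfloor>?z\<rfloor>"
    unfolding column_height_def using upper_boundary_nonneg[OF assms(1)] assms(2) by simp
  then have "\<bar>real (column_height K l m) + 1/2 - ?z\<bar> \<le> 1/2" by linarith
  then have "\<bar>real (column_height K l m) + 1/2 - ?z\<bar> / l \<le> (1/2) / l"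
    using assms(2) by (intro divide_right_mono) auto
  then show ?thesis using assms(2)
    by (simp add: diff_divide_distrib add_divide_distrib abs_div_pos)
qed

text \<open>
  The step function whose integral is the Riemann sum. The cell \<open>((m - 1) / l, m / l]\<close> carries the value at its
  right end point, so the abscissa is never \<open>0\<close>. Cells with \<open>m / l\<close> beyond \<open>half_width K\<close> carry no lattice
  column and get the value \<open>0\<close>.
\<close>

definition riemann_step :: "complex \<Rightarrow> (real \<times> real) set \<Rightarrow> real \<Rightarrow> real \<Rightarrow> complex" where
  "riemann_step \<tau> K l x =
     (if \<lceil>l * x\<rceil> \<in> {1..\<lfloor>l * half_width K\<rfloor>}
      then residual_kernel \<tau> (of_int \<lceil>l * x\<rceil> / l) ((real (column_height K l \<lceil>l * x\<rceil>) + 1/2) / l) else 0)"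

lemma has_integral_riemann_step:
  assumes "K \<in> sym_convex_bodies" "l > 0" "half_width K \<le> A"
  shows "(riemann_step \<tau> K l has_integral
           (\<Sum>m=1..\<lfloor>l * half_width K\<rfloor>. residual_kernel \<tau> (of_int m) (real (column_height K l m) + 1/2))) {0..A}"
proof -
  have "of_int \<lfloor>l * half_width K\<rfloor> / l \<le> half_width K"
    using assms(2) of_int_floor_le[of "l * half_width K"] by (simp add: field_simps)
  then have "of_int \<lfloor>l * half_width K\<rfloor> / l \<le> A" using assms(3) by linarith
  from has_integral_step_function[OF assms(2) this,
      of "\<lambda>m. of_real l * residual_kernel \<tau> (of_int m) (real (column_height K l m) + 1/2)"]
  show ?thesis
    using assms(2) unfolding riemann_step_def residual_kernel_scale[OF assms(2)]
    by (simp add: residual_kernel_scale[OF assms(2), symmetric])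
qed

text \<open>
  Since \<open>K\<close> contains a square of half-side \<open>r\<close>, \<open>x + h(x) \<ge> r\<close> for \<open>0 \<le> x \<le> half_width K\<close>. Rounding to the
  lattice costs at most \<open>1 / (2 l)\<close>, so for \<open>l \<ge> 1 / r\<close> the kernel is evaluated where \<open>x + y \<ge> r / 2\<close>, away from
  its singularity.
\<close>

lemma riemann_step_bound:
  assumes "Im \<tau> > 0" "K \<in> sym_convex_bodies"
  obtains L B where "L > 0" "\<And>l x. l \<ge> L \<Longrightarrow> norm (riemann_step \<tau> K l x) \<le> B"
proof -
  obtain C where C: "C > 0" "\<And>x y. norm (residual_kernel \<tau> x y) \<le> C / (\<bar>x\<bar> + \<bar>y\<bar>)"
    using residual_kernel_bound[OF assms(1)] by metis
  obtain r where r: "r > 0" "\<And>x y. \<bar>x\<bar> \<le> r \<Longrightarrow> \<bar>y\<bar> \<le> r \<Longrightarrow> (x, y) \<in> K"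
    using sym_convex_bodies_contains_square[OF assms(2)] by metis
  have "norm (riemann_step \<tau> K l x) \<le> C / (r / 2)" if l: "l \<ge> 1 / r" for l x
  proof (cases "\<lceil>l * x\<rceil> \<in> {1..\<lfloor>l * half_width K\<rfloor>}")
    case True
    define m where "m = \<lceil>l * x\<rceil>"
    define p q where "p = of_int m / l" and "q = (real (column_height K l m) + 1/2) / l"
    have lpos: "l > 0" using l r(1) by (meson divide_pos_pos less_le_trans zero_less_one)
    have "m \<ge> 1" using True by (simp add: m_def)
    then have p: "p > 0" using lpos by (simp add: p_def)
    have q: "q > 0" using lpos by (simp add: q_def add_nonneg_pos)
    have "r \<le> p + upper_boundary K p"
    proof (cases "p \<le> r")
      case True
      then have "(p, r) \<in> K" using p r by simp
      then show ?thesis using p mem_sym_convex_body_iff[OF assms(2)] by force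
    qed (use upper_boundary_nonneg[OF assms(2), of p] in linarith)
    moreover have "\<bar>q - upper_boundary K p\<bar> \<le> 1 / (2 * l)"
      unfolding p_def q_def by (rule column_height_approx[OF assms(2) lpos])
    moreover have "1 / (2 * l) \<le> r / 2" using l lpos r(1) by (simp add: field_simps)
    ultimately have "r / 2 \<le> p + q" by linarith
    then have "C / (p + q) \<le> C / (r / 2)" using C(1) r(1) p q by (intro divide_left_mono) auto
    moreover have "riemann_step \<tau> K l x = residual_kernel \<tau> p q"
      using True by (simp add: riemann_step_def m_def p_def q_def)
    ultimately show ?thesis using C(2)[of p q] p q by simp
  next
    case False
    then have "riemann_step \<tau> K l x = 0" unfolding riemann_step_def by (rule if_not_P)
    then show ?thesis using C(1) r(1) by simp
  qed
  then show thesis using r(1) by (intro that[of "1 / r" "C / (r / 2)"]) auto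
qed

text \<open>
  The sample points converge to \<open>(x, h(x))\<close> by continuity of the upper boundary. The point \<open>0\<close>, which lies in no
  cell, and the end point \<open>half_width K\<close>, where the upper boundary may jump, are excluded.
\<close>

lemma riemann_step_tendsto:
  assumes "Im \<tau> > 0" "K \<in> sym_convex_bodies"
    and "x \<ge> 0" "x \<noteq> 0" "x \<noteq> half_width K"
  shows "((\<lambda>l. riemann_step \<tau> K l x) \<longlongrightarrow> residual_kernel \<tau> x (upper_boundary K x)) at_top"
proof (cases "x < half_width K")
  case True
  define p where "p l = of_int \<lceil>l * x\<rceil> / l" for l
  define q where "q l = (real (column_height K l \<lceil>l * x\<rceil>) + 1/2) / l" for l
  have p: "(p \<longlongrightarrow> x) at_top"
    unfolding p_def by real_asymp
  have "isCont (upper_boundary K) x"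
    using True assms by (intro isCont_upper_boundary) auto
  then have h: "((\<lambda>l. upper_boundary K (p l)) \<longlongrightarrow> upper_boundary K x) at_top"
    using p by (rule isCont_tendsto_compose)
  have "((\<lambda>l. q l - upper_boundary K (p l)) \<longlongrightarrow> 0) at_top"
  proof (rule Lim_null_comparison)
    show "\<forall>\<^sub>F l in at_top. norm (q l - upper_boundary K (p l)) \<le> 1 / (2 * l)"
      using eventually_gt_at_top[of 0]
      by eventually_elim (use column_height_approx[OF assms(2)] in \<open>simp add: p_def q_def\<close>)
    show "((\<lambda>l::real. 1 / (2 * l)) \<longlongrightarrow> 0) at_top" by real_asymp
  qed
  from tendsto_add[OF this h] have q: "(q \<longlongrightarrow> upper_boundary K x) at_top" by simp
  have "\<tau>\<^sup>2 * (of_real x)\<^sup>2 - (of_real (upper_boundary K x))\<^sup>2 \<noteq> 0"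
    unfolding residual_kernel_denominator using linear_form_nonzero[OF assms(1)] assms(4) by (metis no_zero_divisors)
  then have "((\<lambda>l. residual_kernel \<tau> (p l) (q l)) \<longlongrightarrow> residual_kernel \<tau> x (upper_boundary K x)) at_top"
    unfolding residual_kernel_def by (intro tendsto_intros p q)
  moreover have "\<forall>\<^sub>F l in at_top. residual_kernel \<tau> (p l) (q l) = riemann_step \<tau> K l x"
    using eventually_gt_at_top[of 0] order_tendstoD(2)[OF p True]
  proof eventually_elim
    case (elim l)
    then have "of_int \<lceil>l * x\<rceil> \<le> l * half_width K" by (simp add: p_def field_simps)
    then have "\<lceil>l * x\<rceil> \<le> \<lfloor>l * half_width K\<rfloor>" by (simp add: le_floor_iff)
    moreover have "0 < l * x" using elim assms by simp
    then have "1 \<le> \<lceil>l * x\<rceil>" by (simp add: one_le_ceiling)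
    ultimately show ?case by (simp add: riemann_step_def p_def q_def)
  qed
  ultimately show ?thesis by (rule Lim_transform_eventually)
next
  case False
  with assms have x: "x > half_width K" by simp
  have "\<forall>\<^sub>F l in at_top. residual_kernel \<tau> x (upper_boundary K x) = riemann_step \<tau> K l x"
    using eventually_gt_at_top[of 0]
  proof eventually_elim
    case (elim l)
    with x have "l * half_width K < l * x" by simp
    then have "\<lfloor>l * half_width K\<rfloor> < \<lceil>l * x\<rceil>" by linarith
    moreover have "upper_boundary K x = 0"
      using x by (intro upper_boundary_outside assms) auto
    ultimately show ?case by (simp add: riemann_step_def residual_kernel_def)
  qed
  then show ?thesis by (rule Lim_transform_eventually[OF tendsto_const])
qed

lemma residual_kernel_riemann_sum_tendsto:
  assumes "Im \<tau> > 0" "K \<in> sym_convex_bodies" "half_width K \<le> A"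
  shows "(\<lambda>x. residual_kernel \<tau> x (upper_boundary K x)) integrable_on {0..A}"
    and "((\<lambda>l. \<Sum>m=1..\<lfloor>l * half_width K\<rfloor>. residual_kernel \<tau> (of_int m) (real (column_height K l m) + 1/2))
           \<longlongrightarrow> integral {0..A} (\<lambda>x. residual_kernel \<tau> x (upper_boundary K x))) at_top"
proof -
  let ?f = "\<lambda>x. residual_kernel \<tau> x (upper_boundary K x)"
  let ?E = "{0, half_width K}"
  let ?S = "\<lambda>l. \<Sum>m=1..\<lfloor>l * half_width K\<rfloor>. residual_kernel \<tau> (of_int m) (real (column_height K l m) + 1/2)"
  obtain L B where L: "L > 0" and B: "\<And>l x. l \<ge> L \<Longrightarrow> norm (riemann_step \<tau> K l x) \<le> B"
    using riemann_step_bound[OF assms(1,2)] by metis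
  have B0: "B \<ge> 0" using B[of L 0] norm_ge_zero order_trans by blast
  \<comment> \<open>Dominated convergence is applied to functions set to \<open>0\<close> at the two points without pointwise
    convergence; this does not change any integral.\<close>
  define off where "off F x = (if x \<in> ?E then 0 else F x)" for F :: "real \<Rightarrow> complex" and x
  have off_iff: "(off F has_integral y) {0..A} \<longleftrightarrow> (F has_integral y) {0..A}" for F y
    by (rule has_integral_spike_finite_eq[of ?E]) (auto simp: off_def)
  have off_integrable: "off F integrable_on {0..A} \<longleftrightarrow> F integrable_on {0..A}" for F
    by (simp add: integrable_on_def off_iff)
  have off_integral: "integral {0..A} (off F) = integral {0..A} F" for F
    by (simp add: integral_def off_iff off_integrable)
  have main: "?f integrable_on {0..A} \<and> (\<lambda>n. ?S (X n)) \<longlonglongrightarrow> integral {0..A} ?f"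
    if X: "filterlim X at_top sequentially" "\<And>n. X n \<ge> L" for X :: "nat \<Rightarrow> real"
  proof -
    have I: "(riemann_step \<tau> K (X n) has_integral ?S (X n)) {0..A}" for n
      using X(2)[of n] L by (intro has_integral_riemann_step assms) auto
    have 1: "off (riemann_step \<tau> K (X n)) integrable_on {0..A}" for n
      using I off_integrable by blast
    have 2: "(\<lambda>_. B) integrable_on {0..A}" by (rule integrable_const_ivl)
    have 3: "norm (off (riemann_step \<tau> K (X n)) x) \<le> B" for n x
      using B[OF X(2)] B0 by (simp add: off_def)
    have 4: "(\<lambda>n. off (riemann_step \<tau> K (X n)) x) \<longlonglongrightarrow> off ?f x" if "x \<in> {0..A}" for x
      using filterlim_compose[OF riemann_step_tendsto[OF assms(1,2)] X(1)] that by (simp add: off_def)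
    have "off ?f integrable_on {0..A}"
      "(\<lambda>n. integral {0..A} (off (riemann_step \<tau> K (X n)))) \<longlonglongrightarrow> integral {0..A} (off ?f)"
      using dominated_convergence[OF 1 2 3 4] by auto
    then show ?thesis using integral_unique[OF I] by (simp add: off_integrable off_integral)
  qed
  have "filterlim (\<lambda>n. L + real n) at_top sequentially" by real_asymp
  from main[OF this] show "?f integrable_on {0..A}" by simp
  show "(?S \<longlongrightarrow> integral {0..A} ?f) at_top"
  proof (rule tendsto_at_topI_sequentially)
    fix X :: "nat \<Rightarrow> real" assume X: "filterlim X at_top sequentially"
    then have ev: "\<forall>\<^sub>F n in sequentially. max L (X n) = X n"
      by (auto simp: filterlim_at_top max_def elim: eventually_mono)
    have "filterlim (\<lambda>n. max L (X n)) at_top sequentially"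
      using filterlim_cong[OF refl refl ev, of at_top] X by blast
    from main[OF this] have "(\<lambda>n. ?S (max L (X n))) \<longlonglongrightarrow> integral {0..A} ?f" by simp
    then show "(\<lambda>n. ?S (X n)) \<longlonglongrightarrow> integral {0..A} ?f"
      by (rule Lim_transform_eventually) (use ev in eventually_elim, simp)
  qed
qed

section \<open>The residual function\<close>

lemma sum_symmetric_int:
  fixes f :: "int \<Rightarrow> complex"
  assumes "\<And>m. f (- m) = f m" "f 0 = 0" "0 \<le> k"
  shows "(\<Sum>m\<in>{-k..k}. f m) = 2 * (\<Sum>m=1..k. f m)"
proof -
  have "{-k..k} = insert 0 ({1..k} \<union> uminus ` {1..k})"
    using assms(3) by (auto simp: image_iff intro!: bexI[of _ "- _"])
  also have "sum f \<dots> = sum f ({1..k} \<union> uminus ` {1..k})"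
    using assms(2) by (subst sum.insert) auto
  also have "\<dots> = sum f {1..k} + sum f (uminus ` {1..k})"
    by (rule sum.union_disjoint) auto
  also have "sum f (uminus ` {1..k}) = sum f {1..k}"
    by (subst sum.reindex) (auto simp: assms(1) inj_on_def)
  finally show ?thesis by simp
qed

text \<open>
  One factor \<open>2\<close> comes from the two boundary terms of a column, the other from the symmetry of \<open>K\<close> in \<open>m\<close>; the
  column \<open>m = 0\<close> has no telescoping part.
\<close>

lemma telescoping_lattice_sum:
  assumes "Im \<tau> > 0" "K \<in> sym_convex_bodies" "l > 0"
  shows "(\<Sum>(m, n)\<in>lattice_points K l. telescoping_term \<tau> m n) =
    4 * (\<Sum>m=1..\<lfloor>l * half_width K\<rfloor>. residual_kernel \<tau> (of_int m) (real (column_height K l m) + 1/2))"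
proof -
  let ?k = "\<lfloor>l * half_width K\<rfloor>"
  define c where "c m = (if m = 0 then 0
      else 2 * residual_kernel \<tau> (of_int m) (real (column_height K l m) + 1/2))" for m
  have "(\<Sum>(m, n)\<in>lattice_points K l. telescoping_term \<tau> m n) =
     (\<Sum>m\<in>{-?k..?k}. \<Sum>n\<in>{-int (column_height K l m)..int (column_height K l m)}. telescoping_term \<tau> m n)"
    unfolding lattice_points_eq_Sigma[OF assms(2,3)] by (subst sum.Sigma) auto
  also have "\<dots> = (\<Sum>m\<in>{-?k..?k}. c m)"
  proof (intro sum.cong refl)
    fix m
    show "(\<Sum>n\<in>{-int (column_height K l m)..int (column_height K l m)}. telescoping_term \<tau> m n) = c m"
      using telescoping_column_sum[OF assms(1)] by (cases "m = 0") (auto simp: c_def telescoping_term_def)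
  qed
  also have "\<dots> = 2 * (\<Sum>m=1..?k. c m)"
  proof (rule sum_symmetric_int)
    show "c (- m) = c m" for m
      using upper_boundary_even[OF assms(2), of "of_int m / l"]
      by (simp add: c_def column_height_def residual_kernel_def)
    show "0 \<le> ?k" using half_width_pos[OF assms(2)] assms(3) by simp
  qed (simp add: c_def)
  also have "(\<Sum>m=1..?k. c m) = (\<Sum>m=1..?k. 2 * residual_kernel \<tau> (of_int m) (real (column_height K l m) + 1/2))"
    by (intro sum.cong) (auto simp: c_def)
  finally show ?thesis by (simp flip: sum_distrib_left)
qed

lemma K_partial_sum_eisenstein_tendsto:
  assumes "Im \<tau> > 0" "K \<in> sym_convex_bodies" "half_width K \<le> A"
  shows "(K_partial_sum K (eisenstein_term \<tau>) \<longlongrightarrow>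
           G2 \<tau> + 4 * integral {0..A} (\<lambda>x. residual_kernel \<tau> x (upper_boundary K x))) at_top"
proof -
  let ?d = "\<lambda>m n. eisenstein_term \<tau> m n - telescoping_term \<tau> m n"
  let ?S = "\<lambda>l. \<Sum>m=1..\<lfloor>l * half_width K\<rfloor>. residual_kernel \<tau> (of_int m) (real (column_height K l m) + 1/2)"
  have "((\<lambda>l. \<Sum>(m, n)\<in>lattice_points K l. ?d m n) \<longlongrightarrow> G2 \<tau>) at_top"
    using has_sum_G2[OF assms(1)] filterlim_lattice_points[OF assms(2)]
    unfolding has_sum_def by (rule filterlim_compose)
  from tendsto_add[OF this tendsto_mult_left[OF residual_kernel_riemann_sum_tendsto(2)[OF assms], of 4]]
  show ?thesis
  proof (rule Lim_transform_eventually)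
    show "\<forall>\<^sub>F l in at_top. (\<Sum>(m, n)\<in>lattice_points K l. ?d m n) + 4 * ?S l
            = K_partial_sum K (eisenstein_term \<tau>) l"
      using eventually_gt_at_top[of 0]
    proof eventually_elim
      case (elim l)
      show ?case
        unfolding telescoping_lattice_sum[OF assms(1,2) elim, symmetric] K_partial_sum_def
        by (simp add: case_prod_unfold flip: sum.distrib)
    qed
  qed
qed

theorem theorem5:
  fixes \<tau> :: complex and K :: "(real \<times> real) set"
  assumes "Im \<tau> > 0" and "K \<in> sym_convex_bodies"
  shows "K_summable K (eisenstein_term \<tau>) \<and>
    (\<forall>A>0. {x. upper_boundary K x \<noteq> 0} \<subseteq> {-A..A} \<longrightarrow>
       (\<lambda>x. of_real (upper_boundary K x) /
             (\<tau>\<^sup>2 * (of_real x)\<^sup>2 - (of_real (upper_boundary K x))\<^sup>2)) integrable_on {0..A} \<and>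
       residual K \<tau> = 4 * integral {0..A}
         (\<lambda>x. of_real (upper_boundary K x) /
             (\<tau>\<^sup>2 * (of_real x)\<^sup>2 - (of_real (upper_boundary K x))\<^sup>2)))"
proof (intro conjI allI impI)
  note lim = K_partial_sum_eisenstein_tendsto[OF assms]
  show "K_summable K (eisenstein_term \<tau>)"
    unfolding K_summable_def using lim[OF order_refl] by blast
  fix A :: real
  assume "A > 0" "{x. upper_boundary K x \<noteq> 0} \<subseteq> {-A..A}"
  then have A: "half_width K \<le> A" by (rule half_width_le_support_bound[OF assms(2)])
  show "(\<lambda>x. of_real (upper_boundary K x) /
             (\<tau>\<^sup>2 * (of_real x)\<^sup>2 - (of_real (upper_boundary K x))\<^sup>2)) integrable_on {0..A}"
    using residual_kernel_riemann_sum_tendsto(1)[OF assms A] unfolding residual_kernel_def .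
  have "G2_K K \<tau> = G2 \<tau> + 4 * integral {0..A} (\<lambda>x. residual_kernel \<tau> x (upper_boundary K x))"
    unfolding G2_K_def K_sum_def using lim[OF A] by (intro tendsto_Lim) auto
  then show "residual K \<tau> = 4 * integral {0..A}
         (\<lambda>x. of_real (upper_boundary K x) /
             (\<tau>\<^sup>2 * (of_real x)\<^sup>2 - (of_real (upper_boundary K x))\<^sup>2))"
    unfolding residual_def residual_kernel_def by simp
qed

end
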